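(* Let $I^+(0)$ be the set of all points of the quaternion $\mathbb H$-type group $\mathbf H=\mathbb R^4\times\mathbb R^3$ (with its sub-Lorentzian metric $Q$) that can be reached from the origin $0$ along a timelike future directed curve in $\mathbf H$, and let $$\Gamma_0=\{(x,z)\in\mathbf H:\ -x_1^2+x_2^2+x_3^2+x_4^2<0,\ x_1>0\}.$$ Then $I^+(0)\subset\Gamma_0$.
   Context: The quaternion $\mathbb H$-type group $\mathbf H$ is $\mathbb R^4\times\mathbb R^3$ with coordinates $(x,z)=(x_1,\dots,x_4,z_1,z_2,z_3)$ and unit element $0=(0,0)$. Its horizontal bundle $T_h\mathbf H$ is spanned by the left-invariant vector fields $$X_1=\partial_{x_1}+\tfrac12(x_2\partial_{z_1}-x_4\partial_{z_2}-x_3\partial_{z_3}),\quad X_2=\partial_{x_2}+\tfrac12(-x_1\partial_{z_1}-x_3\partial_{z_2}+x_4\partial_{z_3}),$$ $$X_3=\partial_{x_3}+\tfrac12(x_4\partial_{z_1}+x_2\partial_{z_2}+x_1\partial_{z_3}),\quad X_4=\partial_{x_4}+\tfrac12(-x_3\partial_{z_1}+x_1\partial_{z_2}-x_2\partial_{z_3}).$$ The Lorentzian metric $Q$ on $T_h\mathbf H$ is given by $Q(X_1,X_1)=-1$, $Q(X_i,X_i)=1$ for $i=2,3,4$, and $Q(X_i,X_j)=0$ for $i\ne j$. A horizontal curve is an absolutely continuous curve $c:[0,T]\to\mathbf H$, $T>0$, whose tangent vector $\dot c$ lies in $T_h\mathbf H$ (for almost every parameter value). A horizontal vector $v$ is timelike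 if $Q(v,v)<0$; a timelike vector $v$ at $p$ is future directed if $Q(v,X_1(p))<0$. A horizontal curve is timelike future directed if its tangent vector is timelike and future directed (for almost every parameter value). *)

theory Defs
  imports "HOL-Analysis.Analysis"
begin

type_synonym H_group = "(real^4) \<times> (real^3)"

(* The numeral 4 of the index type 4 is also its zero, so that component $ 4 is x_4.
   The vector field vf i is X_i, written in the basis of coordinate fields d/dx_j, d/dz_k. *)
definition vf :: "4 \<Rightarrow> H_group \<Rightarrow> H_group" where
  "vf i p = (let x = fst p in
     (axis i 1,
      (1/2) *\<^sub>R
        (if i = 1 then vector [x $ 2, - (x $ 4), - (x $ 3)]
         else if i = 2 then vector [- (x $ 1), - (x $ 3), x $ 4]
         else if i = 3 then vector [x $ 4, x $ 2, x $ 1]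
         else vector [- (x $ 3), x $ 1, - (x $ 2)])))"

definition frame :: "H_group \<Rightarrow> H_group set" where
  "frame p = range (\<lambda>i. vf i p)"

definition horizontal_space :: "H_group \<Rightarrow> H_group set" where
  "horizontal_space p = span (frame p)"

(* The bilinear form on horizontal_space p whose matrix in the frame X_1, ..., X_4 is
   diag(-1, 1, 1, 1): see Q_vf and bilinear_Q below. Off horizontal_space p it takes the
   junk value 0; all uses below are restricted to horizontal vectors. *)
definition Q :: "H_group \<Rightarrow> H_group \<Rightarrow> H_group \<Rightarrow> real" where
  "Q p v w = (\<Sum>i\<in>UNIV. (if i = 1 then -1 else 1) *
     (representation (frame p) v (vf i p) * representation (frame p) w (vf i p)))"

definition timelike :: "H_group \<Rightarrow> H_group \<Rightarrow> bool" where
  "timelike p v \<longleftrightarrow> v \<in> horizontal_space p \<and> Q p v v < 0"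

definition timelike_future_directed :: "H_group \<Rightarrow> H_group \<Rightarrow> bool" where
  "timelike_future_directed p v \<longleftrightarrow> timelike p v \<and> Q p v (vf 1 p) < 0"

(* Absolute continuity of functions; absolutely_continuous in HOL-Analysis is about measures. *)
definition abs_continuous_on_interval :: "real \<Rightarrow> real \<Rightarrow> (real \<Rightarrow> 'a::metric_space) \<Rightarrow> bool" where
  "abs_continuous_on_interval a b c \<longleftrightarrow>
     (\<forall>\<epsilon>>0. \<exists>\<delta>>0. \<forall>(n::nat) (u::nat \<Rightarrow> real) v.
        (\<forall>k<n. a \<le> u k \<and> u k \<le> v k \<and> v k \<le> b) \<longrightarrow>
        disjoint_family_on (\<lambda>k. {u k<..<v k}) {..<n} \<longrightarrow>
        (\<Sum>k<n. v k - u k) < \<delta> \<longrightarrow>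
        (\<Sum>k<n. dist (c (u k)) (c (v k))) < \<epsilon>)"

(* Only the values of c on {0..T} matter. That the tangent vector exists almost everywhere is
   part of the condition; for an absolutely continuous c it always does. *)
definition horizontal_curve :: "real \<Rightarrow> (real \<Rightarrow> H_group) \<Rightarrow> bool" where
  "horizontal_curve T c \<longleftrightarrow> T > 0 \<and> abs_continuous_on_interval 0 T c \<and>
     (AE t in lebesgue_on {0..T}. \<exists>v. (c has_vector_derivative v) (at t within {0..T}) \<and>
        v \<in> horizontal_space (c t))"

definition timelike_future_directed_curve :: "real \<Rightarrow> (real \<Rightarrow> H_group) \<Rightarrow> bool" where
  "timelike_future_directed_curve T c \<longleftrightarrow> horizontal_curve T c \<and>
     (AE t in lebesgue_on {0..T}. \<exists>v. (c has_vector_derivative v) (at t within {0..T}) \<and>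
        timelike_future_directed (c t) v)"

definition chronological_future :: "H_group \<Rightarrow> H_group set" where
  "chronological_future p =
     {q. \<exists>T c. timelike_future_directed_curve T c \<and> c 0 = p \<and> c T = q}"

definition Gamma0 :: "H_group set" where
  "Gamma0 = {(x, z). - ((x $ 1)^2) + (x $ 2)^2 + (x $ 3)^2 + (x $ 4)^2 < 0 \<and> x $ 1 > 0}"

lemma fst_vf [simp]: "fst (vf i p) = axis i 1"
  by (simp add: vf_def Let_def)

lemma inj_vf: "inj (\<lambda>i. vf i p)"
  by (rule injI) (metis fst_vf axis_eq_axis zero_neq_one)

lemma independent_frame: "independent (frame p)"
proof (rule independent_if_scalars_zero)
  show "finite (frame p)" by (simp add: frame_def)
next
  fix f v assume s: "(\<Sum>x\<in>frame p. f x *\<^sub>R x) = 0" and v: "v \<in> frame p"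
  from v obtain j where j: "v = vf j p" by (auto simp: frame_def)
  have "(\<Sum>i\<in>UNIV. f (vf i p) *\<^sub>R vf i p) = 0"
    using s by (simp add: frame_def sum.reindex[OF inj_vf] o_def)
  then have "fst (\<Sum>i\<in>UNIV. f (vf i p) *\<^sub>R vf i p) $ j = 0" by simp
  then show "f v = 0"
    by (simp add: fst_sum axis_def j if_distrib cong: if_cong)
qed

lemma Q_vf: "Q p (vf i p) (vf j p) = (if i = j then if i = 1 then -1 else 1 else 0)"
proof -
  have r: "representation (frame p) (vf k p) (vf l p) = (if k = l then 1 else 0)" for k l
    using representation_basis[OF independent_frame, of "vf k p" p] inj_vf[of p]
    by (auto simp: frame_def inj_def)
  show ?thesis
    by (simp add: Q_def r if_distrib[of "\<lambda>x. _ * x"] cong: if_cong)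
qed

lemma bilinear_Q:
  assumes "v \<in> horizontal_space p" "v' \<in> horizontal_space p" "w \<in> horizontal_space p"
  shows "Q p (a *\<^sub>R v + b *\<^sub>R v') w = a * Q p v w + b * Q p v' w"
    and "Q p w (a *\<^sub>R v + b *\<^sub>R v') = a * Q p w v + b * Q p w v'"
proof -
  have r: "representation (frame p) (a *\<^sub>R v + b *\<^sub>R v') =
      (\<lambda>u. a * representation (frame p) v u + b * representation (frame p) v' u)"
    using assms
    by (simp add: horizontal_space_def independent_frame span_scale representation_add
        representation_scale)
  show "Q p (a *\<^sub>R v + b *\<^sub>R v') w = a * Q p v w + b * Q p v' w"
    "Q p w (a *\<^sub>R v + b *\<^sub>R v') = a * Q p w v + b * Q p w v'"
    by (simp_all add: Q_def r sum_distrib_left sum.distrib[symmetric] algebra_simps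
        cong: if_cong)
qed

end

theory Submission
  imports Defs
begin

text \<open>
  Fix a vector \<open>w\<close> of \<open>\<real>\<^sup>3\<close> with \<open>\<bar>w\<bar> \<le> 1\<close>. Along a timelike future directed curve the
  linear functional \<open>x\<^sub>1 - w \<bullet> (x\<^sub>2, x\<^sub>3, x\<^sub>4)\<close> is absolutely continuous with positive derivative
  almost everywhere, by Cauchy--Schwarz, so it is strictly increasing. Taking for \<open>w\<close> the
  direction of \<open>(x\<^sub>2, x\<^sub>3, x\<^sub>4)\<close> at the endpoint gives the claim.
  Monotonicity of an absolutely continuous function is obtained from a tagged division whose
  intervals tagged in the exceptional null set have small total length.
\<close>

section \<open>Absolutely continuous functions\<close>

text \<open>The definition enumerates its intervals by natural numbers, whereas the intervals of a
  tagged division are indexed by the pairs of tag and interval. An enumeration \<open>h\<close> of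
  \<open>S\<close> carries the condition from one to the other.\<close>

lemma abs_continuous_on_interval_finite:
  fixes c :: "real \<Rightarrow> 'a::metric_space"
  assumes "abs_continuous_on_interval a b c" "\<epsilon> > 0"
  obtains \<delta> where "\<delta> > 0"
    "\<And>(S::'i set) u v. finite S \<Longrightarrow> (\<And>i. i \<in> S \<Longrightarrow> a \<le> u i \<and> u i \<le> v i \<and> v i \<le> b) \<Longrightarrow>
       disjoint_family_on (\<lambda>i. {u i<..<v i}) S \<Longrightarrow> (\<Sum>i\<in>S. v i - u i) < \<delta> \<Longrightarrow>
       (\<Sum>i\<in>S. dist (c (u i)) (c (v i))) < \<epsilon>"
proof -
  obtain \<delta> where "\<delta> > 0" and \<delta>: "\<And>(n::nat) (u::nat \<Rightarrow> real) v.
        (\<forall>k<n. a \<le> u k \<and> u k \<le> v k \<and> v k \<le> b) \<Longrightarrow>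
        disjoint_family_on (\<lambda>k. {u k<..<v k}) {..<n} \<Longrightarrow>
        (\<Sum>k<n. v k - u k) < \<delta> \<Longrightarrow> (\<Sum>k<n. dist (c (u k)) (c (v k))) < \<epsilon>"
    using assms unfolding abs_continuous_on_interval_def by meson
  have "(\<Sum>i\<in>S. dist (c (u i)) (c (v i))) < \<epsilon>"
    if S: "finite S" "\<And>i. i \<in> S \<Longrightarrow> a \<le> u i \<and> u i \<le> v i \<and> v i \<le> b"
      "disjoint_family_on (\<lambda>i. {u i<..<v i}) S" "(\<Sum>i\<in>S. v i - u i) < \<delta>"
    for S :: "'i set" and u v
  proof -
    obtain h where h: "bij_betw h {..<card S} S"
      using ex_bij_betw_nat_finite[OF \<open>finite S\<close>] by (auto simp: atLeast0LessThan)
    have "disjoint_family_on (\<lambda>k. {u (h k)<..<v (h k)}) {..<card S}"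
      unfolding disjoint_family_on_def
    proof (intro ballI impI)
      fix m n assume "m \<in> {..<card S}" "n \<in> {..<card S}" "m \<noteq> n"
      then have "h m \<in> S" "h n \<in> S" "h m \<noteq> h n"
        using h by (auto simp: bij_betw_def inj_on_def)
      then show "{u (h m)<..<v (h m)} \<inter> {u (h n)<..<v (h n)} = {}"
        using S(3) unfolding disjoint_family_on_def by blast
    qed
    moreover have "(\<Sum>k<card S. v (h k) - u (h k)) < \<delta>"
      using S(4) sum.reindex_bij_betw[OF h, of "\<lambda>i. v i - u i"] by simp
    ultimately have "(\<Sum>k<card S. dist (c (u (h k))) (c (v (h k)))) < \<epsilon>"
      using S(2) h by (intro \<delta>) (auto dest: bij_betwE)
    then show ?thesis
      using sum.reindex_bij_betw[OF h, of "\<lambda>i. dist (c (u i)) (c (v i))"] by simp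
  qed
  then show thesis
    using that \<open>\<delta> > 0\<close> by blast
qed

lemma abs_continuous_on_subinterval:
  assumes "abs_continuous_on_interval a b c" "a \<le> a'" "b' \<le> b"
  shows "abs_continuous_on_interval a' b' c"
  unfolding abs_continuous_on_interval_def
proof (intro allI impI)
  fix \<epsilon> :: real assume "\<epsilon> > 0"
  then obtain \<delta> where "\<delta> > 0" and \<delta>: "\<And>(n::nat) (u::nat \<Rightarrow> real) v.
        (\<forall>k<n. a \<le> u k \<and> u k \<le> v k \<and> v k \<le> b) \<Longrightarrow>
        disjoint_family_on (\<lambda>k. {u k<..<v k}) {..<n} \<Longrightarrow>
        (\<Sum>k<n. v k - u k) < \<delta> \<Longrightarrow> (\<Sum>k<n. dist (c (u k)) (c (v k))) < \<epsilon>"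
    using assms(1) unfolding abs_continuous_on_interval_def by meson
  show "\<exists>\<delta>>0. \<forall>(n::nat) (u::nat \<Rightarrow> real) v. (\<forall>k<n. a' \<le> u k \<and> u k \<le> v k \<and> v k \<le> b') \<longrightarrow>
       disjoint_family_on (\<lambda>k. {u k<..<v k}) {..<n} \<longrightarrow>
       (\<Sum>k<n. v k - u k) < \<delta> \<longrightarrow> (\<Sum>k<n. dist (c (u k)) (c (v k))) < \<epsilon>"
    using \<open>\<delta> > 0\<close> assms(2,3) by (intro exI[of _ \<delta>] conjI allI impI \<delta>) force+
qed

text \<open>A bounded linear map is Lipschitz with some constant \<open>B\<close>, so the \<delta>
  that \<open>c\<close> has for \<open>\<epsilon> / B\<close> serves for \<epsilon>.\<close>

lemma abs_continuous_on_interval_bounded_linear: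
  assumes "bounded_linear L" "abs_continuous_on_interval a b c"
  shows "abs_continuous_on_interval a b (\<lambda>t. L (c t))"
  unfolding abs_continuous_on_interval_def
proof (intro allI impI)
  obtain B where "B > 0" and B: "\<And>x. norm (L x) \<le> norm x * B"
    using bounded_linear.pos_bounded[OF assms(1)] by blast
  fix \<epsilon> :: real assume "\<epsilon> > 0"
  then have "\<epsilon> / B > 0" using \<open>B > 0\<close> by simp
  then obtain \<delta> where "\<delta> > 0" and \<delta>: "\<And>(n::nat) (u::nat \<Rightarrow> real) v.
        (\<forall>k<n. a \<le> u k \<and> u k \<le> v k \<and> v k \<le> b) \<Longrightarrow>
        disjoint_family_on (\<lambda>k. {u k<..<v k}) {..<n} \<Longrightarrow>
        (\<Sum>k<n. v k - u k) < \<delta> \<Longrightarrow> (\<Sum>k<n. dist (c (u k)) (c (v k))) < \<epsilon> / B"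
    using assms(2) unfolding abs_continuous_on_interval_def by meson
  have "(\<Sum>k<n. dist (L (c (u k))) (L (c (v k)))) < \<epsilon>"
    if "(\<Sum>k<n. dist (c (u k)) (c (v k))) < \<epsilon> / B" for n and u v :: "nat \<Rightarrow> real"
  proof -
    have "(\<Sum>k<n. dist (L (c (u k))) (L (c (v k)))) \<le> (\<Sum>k<n. dist (c (u k)) (c (v k)) * B)"
    proof (rule sum_mono)
      fix k
      show "dist (L (c (u k))) (L (c (v k))) \<le> dist (c (u k)) (c (v k)) * B"
        using B[of "c (u k) - c (v k)"]
        by (simp only: dist_norm linear_diff[OF bounded_linear.linear[OF assms(1)]])
    qed
    also have "\<dots> = (\<Sum>k<n. dist (c (u k)) (c (v k))) * B"
      by (simp add: sum_distrib_right)
    also have "\<dots> < \<epsilon>"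
      using that \<open>B > 0\<close> by (simp add: pos_less_divide_eq)
    finally show ?thesis .
  qed
  then show "\<exists>\<delta>>0. \<forall>(n::nat) (u::nat \<Rightarrow> real) v. (\<forall>k<n. a \<le> u k \<and> u k \<le> v k \<and> v k \<le> b) \<longrightarrow>
       disjoint_family_on (\<lambda>k. {u k<..<v k}) {..<n} \<longrightarrow>
       (\<Sum>k<n. v k - u k) < \<delta> \<longrightarrow> (\<Sum>k<n. dist (L (c (u k))) (L (c (v k)))) < \<epsilon>"
    using \<open>\<delta> > 0\<close> \<delta> by (intro exI[of _ \<delta>]) blast
qed

section \<open>Functions with positive derivative almost everywhere\<close>

text \<open>A positive derivative at the single point \<open>t\<close> does not make
  \<open>f\<close> monotone near \<open>t\<close>; it only compares \<open>f t\<close> with values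
  on either side. This suffices for intervals that contain their tag \<open>t\<close>.\<close>

lemma has_real_derivative_pos_locally_increasing:
  fixes f :: "real \<Rightarrow> real"
  assumes "(f has_real_derivative l) (at t within S)" "0 < l"
  obtains d where "d > 0"
    "\<And>u v. \<lbrakk>u \<in> S; v \<in> S; u \<le> t; t \<le> v; t - u < d; v - t < d\<rbrakk> \<Longrightarrow> f u \<le> f t \<and> f t \<le> f v"
proof -
  obtain d1 where "d1 > 0" and d1: "\<And>h. h > 0 \<Longrightarrow> t + h \<in> S \<Longrightarrow> h < d1 \<Longrightarrow> f t < f (t + h)"
    using has_real_derivative_pos_inc_right[OF assms] by blast
  obtain d2 where "d2 > 0" and d2: "\<And>h. h > 0 \<Longrightarrow> t - h \<in> S \<Longrightarrow> h < d2 \<Longrightarrow> f (t - h) < f t"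
    using has_real_derivative_pos_inc_left[OF assms] by blast
  show thesis
  proof (rule that)
    show "min d1 d2 > 0" using \<open>d1 > 0\<close> \<open>d2 > 0\<close> by simp
    fix u v assume *: "u \<in> S" "v \<in> S" "u \<le> t" "t \<le> v" "t - u < min d1 d2" "v - t < min d1 d2"
    show "f u \<le> f t \<and> f t \<le> f v"
      using d1[of "v - t"] d2[of "t - u"] * by (cases "u = t"; cases "v = t") auto
  qed
qed

text \<open>The increment \<open>f b - f a\<close> is the sum of the increments over a tagged
  division. Those with tag outside \<open>N\<close> are nonnegative because of the derivative at the
  tag; those with tag in \<open>N\<close> add up to more than \<open>- \<epsilon>\<close> by
  absolute continuity.\<close>

lemma abs_continuous_AE_pos_derivative_le:
  fixes f :: "real \<Rightarrow> real"
  assumes ac: "abs_continuous_on_interval a b f" and "a \<le> b" and N: "negligible N"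
    and der: "\<And>t. t \<in> {a..b} - N \<Longrightarrow> \<exists>l>0. (f has_real_derivative l) (at t within {a..b})"
  shows "f a \<le> f b"
proof (rule field_le_epsilon)
  fix \<epsilon> :: real assume "\<epsilon> > 0"
  obtain \<delta> where "\<delta> > 0" and \<delta>:
    "\<And>(S::(real \<times> real set) set) u v. finite S \<Longrightarrow>
       (\<And>i. i \<in> S \<Longrightarrow> a \<le> u i \<and> u i \<le> v i \<and> v i \<le> b) \<Longrightarrow>
       disjoint_family_on (\<lambda>i. {u i<..<v i}) S \<Longrightarrow> (\<Sum>i\<in>S. v i - u i) < \<delta> \<Longrightarrow>
       (\<Sum>i\<in>S. dist (f (u i)) (f (v i))) < \<epsilon>"
    by (rule abs_continuous_on_interval_finite[OF ac \<open>\<epsilon> > 0\<close>]) blast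
  have N': "N \<in> null_sets lebesgue"
    using N by (simp add: negligible_iff_null_sets)
  \<comment> \<open>Outer regularity gives an open \<open>U\<close> around \<open>N\<close>; as
    \<open>N\<close> is null, \<open>U\<close> itself has measure below \<delta>.\<close>
  obtain U where "open U" "N \<subseteq> U" and UN: "emeasure lebesgue (U - N) < ennreal \<delta>"
    using sets_lebesgue_outer_open[of N \<delta>] null_setsD2[OF N'] \<open>\<delta> > 0\<close> by metis
  have U: "emeasure lebesgue U < ennreal \<delta>"
    using UN emeasure_Diff_null_set[OF N' lebesgue_openin[of UNIV U]] \<open>open U\<close> by simp
  \<comment> \<open>The radius of the gauge at \<open>t\<close>. On \<open>N\<close> it confines the
    ball to \<open>U\<close>; at the other points of \<open>{a..b}\<close> it makes \<open>f\<close>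
    nondecreasing across every short interval straddling \<open>t\<close>. Elsewhere any radius will
    do.\<close>
  have "\<exists>d>0. (t \<in> N \<longrightarrow> ball t d \<subseteq> U) \<and> (t \<in> {a..b} - N \<longrightarrow>
      (\<forall>u\<in>{a..b}. \<forall>v\<in>{a..b}. u \<le> t \<longrightarrow> t \<le> v \<longrightarrow> t - u < d \<longrightarrow> v - t < d \<longrightarrow> f u \<le> f v))" for t
  proof (cases "t \<in> N")
    case True
    then obtain e where "e > 0" "ball t e \<subseteq> U"
      using \<open>open U\<close> \<open>N \<subseteq> U\<close> by (meson openE subsetD)
    with True show ?thesis by blast
  next
    case False
    show ?thesis
    proof (cases "t \<in> {a..b}")
      case True
      with False der obtain l where "(f has_real_derivative l) (at t within {a..b})" "l > 0" by blast
      then obtain e where "e > 0" and e: "\<And>u v. \<lbrakk>u \<in> {a..b}; v \<in> {a..b}; u \<le> t; t \<le> v;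
          t - u < e; v - t < e\<rbrakk> \<Longrightarrow> f u \<le> f t \<and> f t \<le> f v"
        by (rule has_real_derivative_pos_locally_increasing) blast
      have "f u \<le> f v" if "u \<in> {a..b}" "v \<in> {a..b}" "u \<le> t" "t \<le> v" "t - u < e" "v - t < e" for u v
        using e[OF that] by linarith
      with False \<open>e > 0\<close> show ?thesis by blast
    next
      case notin: False
      then show ?thesis using False by (intro exI[of _ 1]) auto
    qed
  qed
  then obtain d where d: "\<And>t. d t > 0" and dU: "\<And>t. t \<in> N \<Longrightarrow> ball t (d t) \<subseteq> U"
    and dm: "\<And>t u v. t \<in> {a..b} - N \<Longrightarrow> u \<in> {a..b} \<Longrightarrow> v \<in> {a..b} \<Longrightarrow> u \<le> t \<Longrightarrow> t \<le> v \<Longrightarrow>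
        t - u < d t \<Longrightarrow> v - t < d t \<Longrightarrow> f u \<le> f v"
    by metis
  have "gauge (\<lambda>t. ball t (d t))"
    using d by (simp add: gauge_def)
  then obtain p where p: "p tagged_division_of {a..b}" and fine: "(\<lambda>t. ball t (d t)) fine p"
    by (rule fine_division_exists_real)
  have "finite p" using p by blast
  \<comment> \<open>The endpoints are written as \<open>Inf\<close> and \<open>Sup\<close> to match
    \<open>additive_tagged_division_1\<close>, which does the telescoping.\<close>
  define u v where "u i = Inf (snd i)" and "v i = Sup (snd i)" for i :: "real \<times> real set"
  have I: "snd i = {u i..v i}" "u i \<le> fst i" "fst i \<le> v i" "a \<le> u i" "v i \<le> b"
      "{u i..v i} \<subseteq> ball (fst i) (d (fst i))" if "i \<in> p" for i
  proof -
    obtain t K where i: "i = (t, K)" by fastforce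
    have K: "t \<in> K" "K \<subseteq> {a..b}" "K \<subseteq> ball t (d t)" "\<exists>x y. K = cbox x y"
      using that p fine unfolding i fine_def by (blast dest: tagged_division_ofD)+
    then obtain x y where xy: "K = {x..y}" by auto
    with K(1) have le: "x \<le> y" by auto
    then show "snd i = {u i..v i}" "u i \<le> fst i" "fst i \<le> v i" "a \<le> u i" "v i \<le> b"
      "{u i..v i} \<subseteq> ball (fst i) (d (fst i))"
      using K unfolding u_def v_def i xy by auto
  qed
  define S where "S = {i \<in> p. fst i \<in> N}"
  have "finite S" "S \<subseteq> p" using \<open>finite p\<close> by (auto simp: S_def)
  have disj: "disjoint_family_on (\<lambda>i. {u i<..<v i}) S"
    unfolding disjoint_family_on_def
  proof (intro ballI impI)
    fix i j assume "i \<in> S" "j \<in> S" "i \<noteq> j"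
    then have ij: "i \<in> p" "j \<in> p" "i \<noteq> j" using \<open>S \<subseteq> p\<close> by auto
    then have "interior (snd i) \<inter> interior (snd j) = {}"
      using tagged_division_ofD(5)[OF p, of "fst i" "snd i" "fst j" "snd j"] by simp
    then show "{u i<..<v i} \<inter> {u j<..<v j} = {}"
      using I(1)[OF ij(1)] I(1)[OF ij(2)] by simp
  qed
  have uv: "a \<le> u i \<and> u i \<le> v i \<and> v i \<le> b" if "i \<in> S" for i
    using I(2-5)[of i] that \<open>S \<subseteq> p\<close> by auto
  \<comment> \<open>The total length of the intervals tagged in \<open>N\<close> is the measure of
    their disjoint union of interiors, which lies in \<open>U\<close>.\<close>
  have "ennreal (\<Sum>i\<in>S. v i - u i) = (\<Sum>i\<in>S. ennreal (v i - u i))"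
    using uv by (simp add: sum_ennreal)
  also have "\<dots> = (\<Sum>i\<in>S. emeasure lebesgue {u i<..<v i})"
    using uv by (intro sum.cong) auto
  also have "\<dots> = emeasure lebesgue (\<Union>i\<in>S. {u i<..<v i})"
    using disj \<open>finite S\<close> by (intro sum_emeasure) auto
  also have "\<dots> \<le> emeasure lebesgue U"
  proof (rule emeasure_mono)
    show "(\<Union>i\<in>S. {u i<..<v i}) \<subseteq> U"
    proof (rule UN_least)
      fix i assume "i \<in> S"
      then have "i \<in> p" "fst i \<in> N" by (auto simp: S_def)
      then show "{u i<..<v i} \<subseteq> U"
        using I(6)[of i] dU[of "fst i"] greaterThanLessThan_subseteq_atLeastAtMost_iff by blast
    qed
    show "U \<in> sets lebesgue" using \<open>open U\<close> by (simp add: borel_open)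
  qed
  finally have "ennreal (\<Sum>i\<in>S. v i - u i) < ennreal \<delta>"
    using U by simp
  then have "(\<Sum>i\<in>S. v i - u i) < \<delta>"
    using \<open>\<delta> > 0\<close> by (metis ennreal_leI not_le)
  then have small: "(\<Sum>i\<in>S. dist (f (u i)) (f (v i))) < \<epsilon>"
    using \<delta>[OF \<open>finite S\<close> uv disj] by blast
  have "f b - f a = (\<Sum>i\<in>p. f (v i) - f (u i))"
    using additive_tagged_division_1[OF \<open>a \<le> b\<close> p, of f] by (simp add: u_def v_def split_def)
  also have "\<dots> = (\<Sum>i\<in>p - S. f (v i) - f (u i)) + (\<Sum>i\<in>S. f (v i) - f (u i))"
    by (rule sum.subset_diff[OF \<open>S \<subseteq> p\<close> \<open>finite p\<close>])
  finally have "f b - f a = (\<Sum>i\<in>p - S. f (v i) - f (u i)) + (\<Sum>i\<in>S. f (v i) - f (u i))" .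
  moreover have "(\<Sum>i\<in>p - S. f (v i) - f (u i)) \<ge> 0"
  proof (rule sum_nonneg)
    fix i assume "i \<in> p - S"
    then have i: "i \<in> p" "fst i \<notin> N" by (auto simp: S_def)
    note Ii = I[OF i(1)]
    have uv: "u i \<in> {u i..v i}" "v i \<in> {u i..v i}" using Ii(2,3) by auto
    have "u i \<in> ball (fst i) (d (fst i))" "v i \<in> ball (fst i) (d (fst i))"
      using subsetD[OF Ii(6) uv(1)] subsetD[OF Ii(6) uv(2)] .
    then have "fst i - u i < d (fst i)" "v i - fst i < d (fst i)"
      by (auto simp: dist_real_def)
    then have "f (u i) \<le> f (v i)"
      using Ii(2-5) i(2) by (intro dm[of "fst i"]) auto
    then show "0 \<le> f (v i) - f (u i)" by simp
  qed
  moreover have "(\<Sum>i\<in>S. f (v i) - f (u i)) \<ge> - (\<Sum>i\<in>S. dist (f (u i)) (f (v i)))"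
    unfolding sum_negf[symmetric] by (intro sum_mono) (simp add: dist_real_def)
  ultimately show "f a \<le> f b + \<epsilon>"
    using small by simp
qed

text \<open>The weak inequality holds on every subinterval. A nonempty open interval is not
  negligible, so some interior \<open>t\<close> has a positive derivative; \<open>f\<close> strictly
  increases just to the right of \<open>t\<close>, and weak monotonicity carries this to both
  endpoints.\<close>

lemma abs_continuous_AE_pos_derivative_less:
  fixes f :: "real \<Rightarrow> real"
  assumes ac: "abs_continuous_on_interval a b f" and "a < b"
    and AE: "AE t in lebesgue_on {a..b}. \<exists>l>0. (f has_real_derivative l) (at t within {a..b})"
  shows "f a < f b"
proof -
  define N where
    "N = {t \<in> {a..b}. \<not> (\<exists>l>0. (f has_real_derivative l) (at t within {a..b}))}"
  have "AE t in lebesgue. t \<in> {a..b} \<longrightarrow>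
      (\<exists>l>0. (f has_real_derivative l) (at t within {a..b}))"
    using AE by (subst (asm) AE_restrict_space_iff) auto
  then have N: "negligible N"
    unfolding negligible_iff_null_sets completion.AE_iff_null_sets N_def
    by (auto elim!: back_subst[of "\<lambda>A. A \<in> null_sets lebesgue"])
  have mono: "f s \<le> f t" if "a \<le> s" "s \<le> t" "t \<le> b" for s t
  proof (rule abs_continuous_AE_pos_derivative_le[where f = f, OF _ _ N])
    show "abs_continuous_on_interval s t f"
      using abs_continuous_on_subinterval[OF ac] that by simp
    show "\<exists>l>0. (f has_real_derivative l) (at x within {s..t})" if "x \<in> {s..t} - N" for x
    proof -
      have sub: "{s..t} \<subseteq> {a..b}" using \<open>a \<le> s\<close> \<open>t \<le> b\<close> by auto
      then have "\<exists>l>0. (f has_real_derivative l) (at x within {a..b})"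
        using that unfolding N_def by blast
      then show ?thesis using DERIV_subset[OF _ sub] by blast
    qed
  qed fact
  have "\<not> {a<..<b} \<subseteq> N"
    using N \<open>a < b\<close> open_not_negligible[of "{a<..<b}"] negligible_subset[of N "{a<..<b}"] by auto
  then obtain t l where t: "a < t" "t < b" and "l > 0"
    "(f has_real_derivative l) (at t within {a..b})"
    unfolding N_def by force
  then obtain d where "d > 0" and d: "\<And>h. h > 0 \<Longrightarrow> t + h \<in> {a..b} \<Longrightarrow> h < d \<Longrightarrow> f t < f (t + h)"
    using has_real_derivative_pos_inc_right by metis
  \<comment> \<open>Halving \<open>d\<close> makes \<open>h < d\<close> strict; the bound
    \<open>b - t\<close> keeps \<open>t + h\<close> in the interval.\<close>
  define h where "h = min (d / 2) (b - t)"
  have h: "h > 0" "h < d" "t + h \<le> b" using \<open>d > 0\<close> t by (auto simp: h_def)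
  have "f a \<le> f t" using mono t by simp
  also have "f t < f (t + h)" using d h t by simp
  also have "\<dots> \<le> f b" using mono[of "t + h" b] h t by simp
  finally show ?thesis .
qed

section \<open>Timelike future directed vectors in frame coordinates\<close>

text \<open>The x-part of \<open>vf i p\<close> is the unit vector \<open>axis i 1\<close>,
  independently of \<open>p\<close>, so the frame coefficients can be read off the x-part of
  \<open>v\<close>.\<close>

lemma representation_frame:
  assumes "v \<in> horizontal_space p"
  shows "representation (frame p) v (vf i p) = fst v $ i"
proof -
  have "(\<Sum>b\<in>frame p. representation (frame p) v b *\<^sub>R b) = v"
    using assms independent_frame
    by (intro real_vector.sum_representation_eq) (auto simp: horizontal_space_def frame_def)
  then have "(\<Sum>j\<in>UNIV. representation (frame p) v (vf j p) *\<^sub>R vf j p) = v"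
    by (simp add: frame_def sum.reindex[OF inj_vf] o_def)
  then have "fst v $ i = fst (\<Sum>j\<in>UNIV. representation (frame p) v (vf j p) *\<^sub>R vf j p) $ i"
    by simp
  then show ?thesis
    by (simp add: fst_sum axis_def if_distrib cong: if_cong)
qed

lemma Q_horizontal:
  assumes "v \<in> horizontal_space p" "w \<in> horizontal_space p"
  shows "Q p v w = - (fst v $ 1 * fst w $ 1) + fst v $ 2 * fst w $ 2
    + fst v $ 3 * fst w $ 3 + fst v $ 4 * fst w $ 4"
  using assms by (simp add: Q_def representation_frame sum_4)

text \<open>Pairing with \<open>vf 1 p\<close> gives minus the first coordinate, so future
  directedness is its positivity.\<close>

lemma timelike_future_directed_iff:
  "timelike_future_directed p v \<longleftrightarrow> v \<in> horizontal_space p \<and> fst v $ 1 > 0 \<and>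
     (fst v $ 2)\<^sup>2 + (fst v $ 3)\<^sup>2 + (fst v $ 4)\<^sup>2 < (fst v $ 1)\<^sup>2"
proof -
  have "vf 1 p \<in> horizontal_space p"
    by (simp add: horizontal_space_def frame_def span_base)
  then show ?thesis
    by (auto simp: timelike_future_directed_def timelike_def Q_horizontal axis_def power2_eq_square)
qed

lemma timelike_future_directed_pairing_pos:
  assumes "timelike_future_directed p v" "w2\<^sup>2 + w3\<^sup>2 + w4\<^sup>2 \<le> 1"
  shows "0 < fst v $ 1 - (w2 * fst v $ 2 + w3 * fst v $ 3 + w4 * fst v $ 4)"
proof -
  define x1 x2 x3 x4 where x: "x1 = fst v $ 1" "x2 = fst v $ 2" "x3 = fst v $ 3" "x4 = fst v $ 4"
  have v: "x1 > 0" "x2\<^sup>2 + x3\<^sup>2 + x4\<^sup>2 < x1\<^sup>2"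
    using assms(1) by (auto simp: timelike_future_directed_iff x)
  \<comment> \<open>Lagrange's identity: the defect in Cauchy-Schwarz is the squared norm of the
    cross product.\<close>
  have "(w2 * x2 + w3 * x3 + w4 * x4)\<^sup>2 + ((w2 * x3 - w3 * x2)\<^sup>2 + (w2 * x4 - w4 * x2)\<^sup>2
      + (w3 * x4 - w4 * x3)\<^sup>2) = (w2\<^sup>2 + w3\<^sup>2 + w4\<^sup>2) * (x2\<^sup>2 + x3\<^sup>2 + x4\<^sup>2)"
    by algebra
  then have "(w2 * x2 + w3 * x3 + w4 * x4)\<^sup>2 \<le> (w2\<^sup>2 + w3\<^sup>2 + w4\<^sup>2) * (x2\<^sup>2 + x3\<^sup>2 + x4\<^sup>2)"
    by (smt (verit) zero_le_power2)
  also have "\<dots> \<le> 1 * (x2\<^sup>2 + x3\<^sup>2 + x4\<^sup>2)"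
    using assms(2) by (intro mult_right_mono) auto
  finally have "(w2 * x2 + w3 * x3 + w4 * x4)\<^sup>2 < x1\<^sup>2"
    using v by simp
  then have "w2 * x2 + w3 * x3 + w4 * x4 < x1"
    using v(1) by (rule power2_less_imp_less[OF _ less_imp_le])
  then show ?thesis by (simp add: x)
qed

section \<open>Linear functionals along timelike future directed curves\<close>

text \<open>Since \<open>L\<close> is bounded and linear, \<open>L\<close> composed with
  \<open>c\<close> is absolutely continuous, and its derivative is \<open>L\<close> of the tangent
  vector, which is positive almost everywhere.\<close>

lemma timelike_future_directed_curve_pairing_less:
  assumes c: "timelike_future_directed_curve T c" and w: "w2\<^sup>2 + w3\<^sup>2 + w4\<^sup>2 \<le> 1"
  defines "L \<equiv> \<lambda>p::H_group. fst p $ 1 - (w2 * fst p $ 2 + w3 * fst p $ 3 + w4 * fst p $ 4)"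
  shows "L (c 0) < L (c T)"
proof (rule abs_continuous_AE_pos_derivative_less[where f = "\<lambda>t. L (c t)"])
  have L: "bounded_linear L"
    unfolding L_def
    by (intro bounded_linear_intros bounded_linear_sub bounded_linear_add
        bounded_linear_compose[OF bounded_linear_vec_nth] bounded_linear_fst
        bounded_linear_const_mult)
  show "0 < T" "abs_continuous_on_interval 0 T (\<lambda>t. L (c t))"
    using c abs_continuous_on_interval_bounded_linear[OF L]
    by (auto simp: timelike_future_directed_curve_def horizontal_curve_def)
  have "AE t in lebesgue_on {0..T}. \<exists>v. (c has_vector_derivative v) (at t within {0..T}) \<and>
      timelike_future_directed (c t) v"
    using c by (simp add: timelike_future_directed_curve_def)
  then show "AE t in lebesgue_on {0..T}.
      \<exists>l>0. ((\<lambda>t. L (c t)) has_real_derivative l) (at t within {0..T})"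
  proof (rule AE_mp, intro AE_I2 impI, elim exE conjE)
    fix t v assume "(c has_vector_derivative v) (at t within {0..T})"
      and v: "timelike_future_directed (c t) v"
    then have "((\<lambda>t. L (c t)) has_vector_derivative L v) (at t within {0..T})"
      using bounded_linear.has_vector_derivative[OF L] by blast
    moreover have "L v > 0"
      using timelike_future_directed_pairing_pos[OF v w] by (simp add: L_def)
    ultimately show "\<exists>l>0. ((\<lambda>t. L (c t)) has_real_derivative l) (at t within {0..T})"
      by (auto simp: has_real_derivative_iff_has_vector_derivative)
  qed
qed

theorem theorem1:
  shows "chronological_future 0 \<subseteq> Gamma0"
proof
  fix q assume "q \<in> chronological_future 0"
  then obtain T c where c: "timelike_future_directed_curve T c" "c 0 = 0" "c T = q"
    by (auto simp: chronological_future_def)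
  define x1 x2 x3 x4 where x: "x1 = fst q $ 1" "x2 = fst q $ 2" "x3 = fst q $ 3" "x4 = fst q $ 4"
  define r where "r = sqrt (x2\<^sup>2 + x3\<^sup>2 + x4\<^sup>2)"
  have r: "r \<ge> 0" "r\<^sup>2 = x2\<^sup>2 + x3\<^sup>2 + x4\<^sup>2"
    by (auto simp: r_def)
  \<comment> \<open>For \<open>r = 0\<close> the quotients are \<open>0\<close>, and both claims about them still hold.\<close>
  have "(x2 / r)\<^sup>2 + (x3 / r)\<^sup>2 + (x4 / r)\<^sup>2 = (x2\<^sup>2 + x3\<^sup>2 + x4\<^sup>2) / r\<^sup>2"
    by (simp add: power_divide add_divide_distrib)
  also have "\<dots> \<le> 1" by (simp flip: r(2))
  \<comment> \<open>The functional vanishes at the starting point \<open>0\<close>. At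
    \<open>q\<close> its value is \<open>x1 - r\<close>, as pairing \<open>(x2, x3, x4)\<close> with
    its own direction gives its norm.\<close>
  finally have "0 < x1 - (x2 / r * x2 + x3 / r * x3 + x4 / r * x4)"
    using timelike_future_directed_curve_pairing_less[OF c(1), of "x2 / r" "x3 / r" "x4 / r"] c
    by (simp add: x)
  also have "x2 / r * x2 + x3 / r * x3 + x4 / r * x4 = (x2\<^sup>2 + x3\<^sup>2 + x4\<^sup>2) / r"
    by (simp add: power2_eq_square add_divide_distrib)
  also have "\<dots> = r\<^sup>2 / r" by (simp only: r(2))
  also have "\<dots> = r" by (simp add: power2_eq_square)
  finally have "r < x1" by simp
  with r(1) have "r\<^sup>2 < x1\<^sup>2" "0 < x1"
    by (auto intro: power_strict_mono)
  then show "q \<in> Gamma0"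
    using r(2) by (cases q) (auto simp: Gamma0_def x)
qed

end
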